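(* Let $(x_n)_{n=1}^{\infty}$ be a sequence on the torus $\mathbb{T}=\mathbb{R}/\mathbb{Z}$. If there exists a sequence of positive real numbers $(t_n)_{n=1}^{\infty}$ converging to $0$ such that $$ \lim_{N \rightarrow \infty} \frac{1}{N^2} \sum_{m,n = 1}^{N} \frac{1}{\sqrt{t_N}} \exp\left(- \frac{1}{t_N} (x_m - x_n)^2 \right) = \sqrt{\pi},$$ then $(x_n)_{n=1}^{\infty}$ is uniformly distributed on $\mathbb{T}$.
   Context: $\mathbb{T}$ is the one-dimensional torus normalized to have length $1$. In $(x_m-x_n)^2$, the quantity $|x_m-x_n|$ denotes the distance on $\mathbb{T}$, i.e. the distance of the difference to the nearest integer. A sequence on $\mathbb{T}$ is uniformly distributed if for every interval (arc) $J\subset\mathbb{T}$, $\lim_{N\to\infty}\frac1N\#\{1\le i\le N: x_i\in J\}=|J|$, where $|J|$ is the length of $J$. *)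

theory Defs
  imports Complex_Main
begin

definition torus_rel :: "real \<Rightarrow> real \<Rightarrow> bool" where
  "torus_rel x y \<longleftrightarrow> x - y \<in> \<int>"

lemma equivp_torus_rel: "equivp torus_rel"
proof (rule equivpI)
  show "reflp torus_rel"
    by (simp add: reflp_def torus_rel_def)
  show "symp torus_rel"
    unfolding symp_def torus_rel_def by (metis Ints_minus minus_diff_eq)
  show "transp torus_rel"
    unfolding transp_def torus_rel_def by (metis Ints_add diff_add_cancel add_diff_eq)
qed

quotient_type torus = real / torus_rel
  by (rule equivp_torus_rel)

lift_definition torus_dist :: "torus \<Rightarrow> torus \<Rightarrow> real"
  is "\<lambda>x y. \<bar>(x - y) - of_int (round (x - y))\<bar>"
proof -
  fix a a' b b' :: real
  assume "torus_rel a a'" "torus_rel b b'"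
  then obtain k l :: int where "a = a' + of_int k" "b = b' + of_int l"
    unfolding torus_rel_def by (metis Ints_cases add.commute diff_add_cancel)
  then have eq: "a - b = (a' - b') + of_int (k - l)"
    by simp
  have "round (a - b) = round (a' - b') + (k - l)"
    unfolding eq round_def by (metis add.assoc add.commute floor_add_int)
  then show "\<bar>(a - b) - of_int (round (a - b))\<bar> = \<bar>(a' - b') - of_int (round (a' - b'))\<bar>"
    unfolding eq by simp
qed

text \<open>An arc of length \<open>l \<le> 1\<close> is the projection to the torus of a real interval of length
  \<open>l\<close>. Its endpoints may or may not belong to it, and degenerate arcs are allowed.\<close>

definition is_arc :: "torus set \<Rightarrow> real \<Rightarrow> bool" where
  "is_arc J l \<longleftrightarrow>
    (\<exists>a b. a \<le> b \<and> b \<le> a + 1 \<and> l = b - a \<and>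
      J \<in> {abs_torus ` {a..b}, abs_torus ` {a..<b}, abs_torus ` {a<..b}, abs_torus ` {a<..<b}})"

text \<open>Sequences are indexed from \<open>1\<close>; the value at \<open>0\<close> is irrelevant.\<close>

definition uniformly_distributed :: "(nat \<Rightarrow> torus) \<Rightarrow> bool" where
  "uniformly_distributed x \<longleftrightarrow>
    (\<forall>J l. is_arc J l \<longrightarrow>
      (\<lambda>N. real (card {i \<in> {1..N}. x i \<in> J}) / real N) \<longlonglongrightarrow> l)"

end

(*
  Let q be the heat kernel exp(-2 d(u,0)^2/t) on the torus, normalized by the mass of the Gaussian
  on the line, and f_N(z) the average of q(z - x_n) over n <= N. A product of two Gaussians is again
  a Gaussian, so up to an exponentially small wrap-around error the integral of f_N^2 is the energy
  in the hypothesis divided by sqrt pi, which tends to 1. As the integral of f_N tends to 1 as well,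
  f_N tends to 1 in L^2. Integrating f_N over a slightly shrunk arc shows that every open arc
  receives asymptotically at least its share of the points; applied to the complementary arc, this
  also gives the upper bound.
*)
theory Submission
  imports Defs "HOL-Probability.Distributions" "HOL-Real_Asymp.Real_Asymp"
begin

section \<open>Distance to the nearest integer, on real representatives\<close>

definition int_dist :: "real \<Rightarrow> real" where
  "int_dist u = \<bar>u - of_int (round u)\<bar>"

lemma torus_dist_abs_torus: "torus_dist (abs_torus a) (abs_torus b) = int_dist (a - b)"
  by (simp add: torus_dist.abs_eq int_dist_def)

lemma int_dist_nonneg [simp]: "0 \<le> int_dist u"
  by (simp add: int_dist_def)

lemma int_dist_le: "int_dist u \<le> \<bar>u - of_int k\<bar>"
  unfolding int_dist_def by (rule round_diff_minimal)

text \<open>Together with \<open>int_dist_le\<close> this makes \<open>int_dist u\<close> a minimum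
  over the integers; periodicity and the Lipschitz bound follow from that alone.\<close>

lemma int_dist_attained: obtains k where "int_dist u = \<bar>u - of_int k\<bar>"
  unfolding int_dist_def by blast

lemma int_dist_le_half: "int_dist u \<le> 1/2"
  using of_int_round_abs_le[of u] by (simp add: int_dist_def abs_minus_commute)

lemma int_dist_add_int: "int_dist (u + of_int k) = int_dist u"
proof (rule antisym)
  obtain j where "int_dist u = \<bar>u - of_int j\<bar>" by (rule int_dist_attained)
  then show "int_dist (u + of_int k) \<le> int_dist u"
    using int_dist_le[of "u + of_int k" "j + k"] by simp
  obtain j where "int_dist (u + of_int k) = \<bar>u + of_int k - of_int j\<bar>" by (rule int_dist_attained)
  then show "int_dist u \<le> int_dist (u + of_int k)"
    using int_dist_le[of u "j - k"] by (simp add: algebra_simps)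
qed

lemma int_dist_lipschitz: "int_dist u \<le> int_dist v + \<bar>u - v\<bar>"
proof -
  obtain j where "int_dist v = \<bar>v - of_int j\<bar>" by (rule int_dist_attained)
  with int_dist_le[of u j] show ?thesis by linarith
qed

text \<open>Since \<open>round\<close> jumps at half-integers, continuity comes from the Lipschitz
  bound and not from the defining formula.\<close>

lemma continuous_on_int_dist: "continuous_on A int_dist"
proof (rule continuous_on_iff[THEN iffD2], intro ballI allI impI)
  fix x e :: real assume "0 < e"
  have "\<bar>int_dist y - int_dist x\<bar> \<le> \<bar>y - x\<bar>" for y
    using int_dist_lipschitz[of x y] int_dist_lipschitz[of y x] by linarith
  then show "\<exists>d>0. \<forall>y\<in>A. dist y x < d \<longrightarrow> dist (int_dist y) (int_dist x) < e"
    using \<open>0 < e\<close> by (intro exI[of _ e]) (auto simp: dist_real_def intro: le_less_trans)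
qed

text \<open>A nonzero integer has absolute value at least \<open>1\<close>, so its distance from
  \<open>u\<close> is at least \<open>1 - \<bar>u\<bar>\<close>.\<close>

lemma int_dist_ge:
  assumes "\<bar>u\<bar> \<le> 1"
  shows "min \<bar>u\<bar> (1 - \<bar>u\<bar>) \<le> int_dist u"
proof -
  obtain j where j: "int_dist u = \<bar>u - of_int j\<bar>" by (rule int_dist_attained)
  consider "j = 0" | "j \<ge> 1" | "j \<le> -1" by linarith
  then show ?thesis
  proof cases
    case 2 then have "(1::real) \<le> of_int j" by simp
    then show ?thesis using assms j by linarith
  next
    case 3 then have "of_int j \<le> (-1::real)" by simp
    then show ?thesis using assms j by linarith
  qed (use j in simp)
qed

lemma int_dist_eq_abs: "\<bar>u\<bar> \<le> 1/2 \<Longrightarrow> int_dist u = \<bar>u\<bar>"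
  using int_dist_ge[of u] int_dist_le[of u 0] by simp

section \<open>Integrals over a period and Gaussian densities on the line\<close>

text \<open>Cutting \<open>{a..b+1}\<close> at \<open>a+1\<close> and at \<open>b\<close> leaves the
  pieces \<open>{a+1..b+1}\<close> and \<open>{a..b}\<close>, which are translates of each other by
  one period.\<close>

lemma integral_periodic:
  fixes F :: "real \<Rightarrow> real"
  assumes cont: "continuous_on UNIV F" and per: "\<And>z. F (z + 1) = F z"
  shows "integral {a..a+1} F = integral {b..b+1} F"
proof -
  have int: "F integrable_on {c..d}" for c d
    by (rule integrable_continuous_interval) (use cont continuous_on_subset in blast)
  have *: "integral {a..a+1} F = integral {b..b+1} F" if "a \<le> b" for a b
  proof -
    have "integral {a..a+1} F + integral {a+1..b+1} F = integral {a..b+1} F"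
      using that int by (intro Henstock_Kurzweil_Integration.integral_combine) auto
    moreover have "integral {a..b} F + integral {b..b+1} F = integral {a..b+1} F"
      using that int by (intro Henstock_Kurzweil_Integration.integral_combine) auto
    moreover have "F \<circ> (+) 1 = F"
      using per by (auto simp: fun_eq_iff add.commute)
    then have "integral {a..b} F = integral {a+1..b+1} F"
      using integral_shift_Icc_real[of a b F 1] by simp
    ultimately show ?thesis by linarith
  qed
  show ?thesis
    using *[of a b] *[of b a] by linarith
qed

lemma normal_density_antimono:
  assumes "\<bar>u\<bar> \<le> \<bar>v\<bar>" shows "normal_density 0 s v \<le> normal_density 0 s u"
proof -
  have "u\<^sup>2 \<le> v\<^sup>2" using assms by (simp add: abs_le_square_iff)
  then show ?thesis
    unfolding normal_density_def
    by (intro mult_left_mono) (auto intro!: divide_right_mono)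
qed

lemma normal_density_abs [simp]: "normal_density 0 s \<bar>u\<bar> = normal_density 0 s u"
  by (simp add: normal_density_def)

lemma continuous_on_normal_density: "continuous_on A (normal_density m s)"
proof (cases "s = 0")
  case False
  then show ?thesis
    unfolding normal_density_def by (intro continuous_intros) auto
\<comment> \<open>For \<open>s = 0\<close> the prefactor is a division by zero, hence
  \<open>0\<close>, and the density vanishes identically.\<close>
qed (simp add: normal_density_def[abs_def])

lemma integrable_on_normal_density: "normal_density m s integrable_on {a..b}"
  by (intro integrable_continuous_interval continuous_on_normal_density)

text \<open>Complete the square: \<open>(z-y)^2 + (z-y')^2 = (y-y')^2/2 + 2*(z-(y+y')/2)^2\<close>.
  Only the second factor depends on \<open>z\<close>, so integrating over \<open>z\<close> leaves a
  Gaussian in \<open>y - y'\<close> of doubled variance.\<close>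

lemma normal_density_mult_normal_density:
  assumes s: "0 < s"
  shows "normal_density y s z * normal_density y' s z =
    normal_density 0 (sqrt 2 * s) (y - y') * normal_density ((y + y') / 2) (s / sqrt 2) z"
proof -
  have "normal_density y s z * normal_density y' s z =
      1 / (2 * pi * s\<^sup>2) * exp (-((z - y)\<^sup>2 + (z - y')\<^sup>2) / (2 * s\<^sup>2))"
    using s by (simp add: normal_density_def exp_add[symmetric] real_sqrt_mult field_simps)
      (simp add: power2_eq_square)
  also have "1 / (2 * pi * s\<^sup>2) = 1 / sqrt (2 * pi * (sqrt 2 * s)\<^sup>2) * (1 / sqrt (2 * pi * (s / sqrt 2)\<^sup>2))"
    using s by (simp add: real_sqrt_mult[symmetric] power_mult_distrib power_divide)
       (simp add: real_sqrt_mult power2_eq_square)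
  also have "-((z - y)\<^sup>2 + (z - y')\<^sup>2) / (2 * s\<^sup>2) =
      -(y - y' - 0)\<^sup>2 / (2 * (sqrt 2 * s)\<^sup>2) + -(z - (y + y') / 2)\<^sup>2 / (2 * (s / sqrt 2)\<^sup>2)"
    using s by (simp add: power_mult_distrib power_divide field_simps) (simp add: power2_eq_square algebra_simps)
  finally show ?thesis
    by (simp only: normal_density_def exp_add mult.assoc mult.left_commute)
qed

lemma integral_normal_density_le_1:
  assumes "0 < s" shows "integral {a..b} (normal_density m s) \<le> 1"
proof -
  have h: "(normal_density m s has_integral 1) UNIV"
    using has_integral_integral_lborel[OF integrable_normal_density[OF assms], of m]
      integral_normal_density[OF assms] by simp
  have "integral {a..b} (normal_density m s) \<le> integral UNIV (normal_density m s)"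
    using h by (intro integral_subset_le integrable_on_normal_density) auto
  also have "\<dots> = 1" using h by (rule integral_unique)
  finally show ?thesis .
qed

text \<open>Chebyshev's inequality, from \<open>1 - 4 u\<^sup>2 \<le> 0\<close> off \<open>[-1/2, 1/2]\<close>.\<close>
lemma integral_normal_density_ge:
  assumes s: "0 < s" shows "1 - 4 * s\<^sup>2 \<le> integral {-1/2..1/2} (normal_density 0 s)"
proof -
  let ?p = "normal_density 0 s"
  have 1: "(?p has_integral 1) UNIV"
    using has_integral_integral_lborel[OF integrable_normal_density[OF s], of 0]
      integral_normal_density[OF s] by simp
  have 2: "((\<lambda>u. ?p u * u\<^sup>2) has_integral s\<^sup>2) UNIV"
  proof -
    have b: "has_bochner_integral lborel (\<lambda>u. ?p u * u\<^sup>2) (s\<^sup>2)"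
      using normal_moment_even[OF s, of 0 1] by (simp add: fact_numeral)
    show ?thesis
      using has_integral_integral_lborel[OF integrable.intros[OF b]]
        has_bochner_integral_integral_eq[OF b] by simp
  qed
  have 3: "((\<lambda>u. if u \<in> {-1/2..1/2} then ?p u else 0) has_integral integral {-1/2..1/2} ?p) UNIV"
    by (simp only: has_integral_restrict_UNIV integrable_integral[OF integrable_on_normal_density])
  show ?thesis
  proof (rule has_integral_le[OF has_integral_diff[OF 1 has_integral_mult_right[OF 2, of 4]] 3])
    fix u :: real
    have "?p u * (1 - 4 * u\<^sup>2) \<le> 0" if "\<not> \<bar>u\<bar> \<le> 1/2"
    proof (rule mult_nonneg_nonpos)
      have "(1/2)\<^sup>2 \<le> \<bar>u\<bar>\<^sup>2" using that by (intro power_mono) auto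
      then show "1 - 4 * u\<^sup>2 \<le> 0" by (simp add: power2_eq_square)
    qed simp
    then show "?p u - 4 * (?p u * u\<^sup>2) \<le> (if u \<in> {-1/2..1/2} then ?p u else 0)"
      by (auto simp: algebra_simps abs_le_iff)
  qed
qed

section \<open>The Gaussian kernel on the torus\<close>

text \<open>This is not the periodized Gaussian: only the nearest translate is kept, with the
  normalization of the line. For \<open>s > 0\<close> its mass over a period is therefore slightly
  below \<open>1\<close>.\<close>

definition torus_gauss :: "real \<Rightarrow> real \<Rightarrow> real" where
  "torus_gauss s u = normal_density 0 s (int_dist u)"

lemma torus_gauss_nonneg [simp]: "0 \<le> torus_gauss s u"
  by (simp add: torus_gauss_def)

lemma torus_gauss_add_int: "torus_gauss s (u + of_int k) = torus_gauss s u"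
  by (simp add: torus_gauss_def int_dist_add_int)

lemma torus_gauss_add_1: "torus_gauss s (z + 1 - y) = torus_gauss s (z - y)"
  using torus_gauss_add_int[of s "z - y" 1] by (simp add: algebra_simps)

lemma continuous_on_torus_gauss: "continuous_on A (\<lambda>z. torus_gauss s (z - y))"
  unfolding torus_gauss_def
  by (intro continuous_on_compose2[OF continuous_on_normal_density[of UNIV]]
    continuous_on_compose2[OF continuous_on_int_dist[of UNIV]] continuous_intros) auto

text \<open>Periodicity moves the window so that it is centred at \<open>y\<close>, where the kernel
  is the Gaussian of the line.\<close>

lemma integral_torus_gauss:
  "integral {a..a+1} (\<lambda>z. torus_gauss s (z - y)) = integral {-1/2..1/2} (normal_density 0 s)"
proof -
  have "integral {a..a+1} (\<lambda>z. torus_gauss s (z - y)) =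
      integral {-1/2 + y..-1/2 + y + 1} (\<lambda>z. torus_gauss s (z - y))"
    by (rule integral_periodic[OF continuous_on_torus_gauss]) (rule torus_gauss_add_1)
  also have "\<dots> = integral {-1/2..1/2} (\<lambda>u. torus_gauss s u)"
    using integral_shift_Icc_real[of "-1/2" "1/2" "\<lambda>z. torus_gauss s (z - y)" y]
    by (simp add: o_def add.commute)
  also have "\<dots> = integral {-1/2..1/2} (normal_density 0 s)"
    by (intro Henstock_Kurzweil_Integration.integral_cong)
      (auto simp: torus_gauss_def int_dist_eq_abs abs_le_iff)
  finally show ?thesis .
qed

text \<open>If \<open>z\<close> is nearer to a translate of \<open>y'\<close> than to \<open>y'\<close> itself, the distances of \<open>z\<close> to \<open>y\<close> and
  \<open>y'\<close> add up to at least \<open>1/2\<close>, so the sum of their squares is at least \<open>1/8\<close>.\<close>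
definition wrap_error :: "real \<Rightarrow> real" where
  "wrap_error s = 1 / (2 * pi * s\<^sup>2) * exp (- 1 / (16 * s\<^sup>2))"

lemma torus_gauss_mult_le:
  assumes s: "0 < s" and z: "\<bar>z - y\<bar> \<le> 1/2" and y: "\<bar>y - y'\<bar> \<le> 1/2"
  shows "torus_gauss s (z - y) * torus_gauss s (z - y') \<le>
    normal_density 0 s (z - y) * normal_density 0 s (z - y') + wrap_error s"
proof (cases "\<bar>z - y'\<bar> \<le> 1/2")
  case True
  have "0 \<le> wrap_error s" by (simp add: wrap_error_def)
  with True z show ?thesis
    by (simp add: torus_gauss_def int_dist_eq_abs)
next
  case False
  define p q where "p = int_dist (z - y)" and "q = int_dist (z - y')"
  have "p = \<bar>z - y\<bar>" using z by (simp add: p_def int_dist_eq_abs)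
  moreover have "1 - \<bar>z - y'\<bar> \<le> q"
    using int_dist_ge[of "z - y'"] False y z unfolding q_def by linarith
  ultimately have "1/2 \<le> p + q" using y by linarith
  then have "(1/2)\<^sup>2 \<le> (p + q)\<^sup>2" by (intro power_mono) auto
  moreover have "(p + q)\<^sup>2 + (p - q)\<^sup>2 = 2 * (p\<^sup>2 + q\<^sup>2)"
    by (simp add: power2_eq_square algebra_simps)
  moreover have "0 \<le> (p - q)\<^sup>2" by simp
  ultimately have "(1/2)\<^sup>2 \<le> 2 * (p\<^sup>2 + q\<^sup>2)" by linarith
  then have pq: "1/8 \<le> p\<^sup>2 + q\<^sup>2" by (simp add: power_divide)
  have "torus_gauss s (z - y) * torus_gauss s (z - y') =
      1 / (2 * pi * s\<^sup>2) * exp (-(p\<^sup>2 + q\<^sup>2) / (2 * s\<^sup>2))"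
    using s by (simp add: torus_gauss_def normal_density_def exp_add[symmetric] real_sqrt_mult
      field_simps flip: p_def q_def) (simp add: power2_eq_square)
  also have "\<dots> \<le> wrap_error s"
  proof -
    \<comment> \<open>The \<open>16\<close> in \<open>wrap_error\<close> is
      \<open>2 / (1/8)\<close>.\<close>
    have "(1/8) / (2 * s\<^sup>2) \<le> (p\<^sup>2 + q\<^sup>2) / (2 * s\<^sup>2)"
      using pq by (intro divide_right_mono) auto
    then show ?thesis
      unfolding wrap_error_def minus_divide_left[symmetric] by (intro mult_left_mono) auto
  qed
  finally show ?thesis by (simp add: add_increasing)
qed

text \<open>Replace \<open>y'\<close> by its translate \<open>w\<close> nearest to \<open>y\<close>
  and centre the period at \<open>y\<close>. There the product is a product of Gaussians on the line
  up to \<open>wrap_error s\<close>; the factor that depends on \<open>z\<close> has mass at most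
  \<open>1\<close>, and the error is integrated over length \<open>1\<close>.\<close>

lemma integral_torus_gauss_mult_le:
  assumes s: "0 < s"
  shows "integral {a..a+1} (\<lambda>z. torus_gauss s (z - y) * torus_gauss s (z - y')) \<le>
    torus_gauss (sqrt 2 * s) (y - y') + wrap_error s"
proof -
  define w where "w = y' + of_int (round (y - y'))"
  have w: "int_dist (y - y') = \<bar>y - w\<bar>"
    by (simp add: w_def int_dist_def algebra_simps)
  have yw: "\<bar>y - w\<bar> \<le> 1/2" using int_dist_le_half[of "y - y'"] w by simp
  have g: "torus_gauss s (z - y') = torus_gauss s (z - w)" for z
    using torus_gauss_add_int[of s "z - w" "round (y - y')"] by (simp add: w_def)
  let ?F = "\<lambda>z. torus_gauss s (z - y) * torus_gauss s (z - w)"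
  let ?b = "normal_density 0 (sqrt 2 * s) (y - w)"
  let ?n = "normal_density ((y + w) / 2) (s / sqrt 2)"
  have cont: "continuous_on A ?F" for A
    by (intro continuous_intros continuous_on_torus_gauss)
  have "integral {a..a+1} ?F = integral {y-1/2..y-1/2+1} ?F"
    by (rule integral_periodic[OF cont]) (simp only: torus_gauss_add_1)
  also have "\<dots> \<le> integral {y-1/2..y-1/2+1} (\<lambda>z. ?b * ?n z + wrap_error s)"
  proof (rule integral_le)
    fix z assume "z \<in> {y-1/2..y-1/2+1}"
    then have "\<bar>z - y\<bar> \<le> 1/2" unfolding abs_le_iff by auto
    from torus_gauss_mult_le[OF s this yw]
    have "?F z \<le> normal_density y s z * normal_density w s z + wrap_error s"
      by (simp add: normal_density_def)
    then show "?F z \<le> ?b * ?n z + wrap_error s"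
      by (simp only: normal_density_mult_normal_density[OF s])
  qed (auto intro!: integrable_continuous_interval cont
      continuous_intros continuous_on_normal_density)
  also have "\<dots> = ?b * integral {y-1/2..y-1/2+1} ?n + wrap_error s"
    by (subst Henstock_Kurzweil_Integration.integral_add) (auto intro!: integrable_continuous_interval continuous_intros
      continuous_on_normal_density)
  also have "\<dots> \<le> ?b * 1 + wrap_error s"
    using s by (intro add_right_mono mult_left_mono integral_normal_density_le_1) auto
  also have "?b = torus_gauss (sqrt 2 * s) (y - y')"
    by (simp add: torus_gauss_def w)
  finally show ?thesis by (simp add: g)
qed


lemma integrable_on_torus_gauss: "(\<lambda>z. torus_gauss s (z - y)) integrable_on {a..b}"
  by (intro integrable_continuous_interval continuous_on_torus_gauss)

section \<open>Mean square deviation of the smoothed point density from 1\<close>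

text \<open>Expand the square. The integral of \<open>f^2\<close> is a double sum of kernel
  products, bounded term by term; the integral of \<open>f\<close> is at least
  \<open>1 - 4 * s^2\<close>, so \<open>-2 f + 1\<close> contributes at most
  \<open>-1 + 8 * s^2\<close>.\<close>

lemma mean_square_deviation_le:
  fixes y :: "nat \<Rightarrow> real"
  assumes s: "0 < s" and N: "1 \<le> N"
  defines "f \<equiv> \<lambda>z. (\<Sum>n=1..N. torus_gauss s (z - y n)) / real N"
  shows "integral {a..a+1} (\<lambda>z. (f z - 1)\<^sup>2) \<le>
    (\<Sum>m=1..N. \<Sum>n=1..N. torus_gauss (sqrt 2 * s) (y m - y n)) / (real N)\<^sup>2
      + wrap_error s - 1 + 8 * s\<^sup>2"
proof -
  let ?q = "\<lambda>n z. torus_gauss s (z - y n)"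
  have cf: "continuous_on A f" for A
    unfolding f_def using N by (intro continuous_intros continuous_on_torus_gauss) auto
  have "integral {a..a+1} f = (\<Sum>n=1..N. integral {a..a+1} (?q n)) / real N"
    unfolding f_def
    by (subst integral_divide, subst integral_sum) (auto intro: integrable_on_torus_gauss)
  also have "\<dots> = integral {-1/2..1/2} (normal_density 0 s)"
    using N by (simp only: integral_torus_gauss) simp
  finally have mean: "1 - 4 * s\<^sup>2 \<le> integral {a..a+1} f"
    using integral_normal_density_ge[OF s] by simp
  have "integral {a..a+1} (\<lambda>z. (f z)\<^sup>2) =
      integral {a..a+1} (\<lambda>z. (\<Sum>m=1..N. \<Sum>n=1..N. ?q m z * ?q n z) / (real N)\<^sup>2)"
    by (simp add: f_def power_divide power2_eq_square sum_product)
  also have "\<dots> = (\<Sum>m=1..N. \<Sum>n=1..N. integral {a..a+1} (\<lambda>z. ?q m z * ?q n z)) / (real N)\<^sup>2"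
    by (simp add: integral_divide integral_sum integrable_sum integrable_continuous_interval
      continuous_on_mult continuous_on_torus_gauss)
  also have "\<dots> \<le> (\<Sum>m=1..N. \<Sum>n=1..N. torus_gauss (sqrt 2 * s) (y m - y n) + wrap_error s) / (real N)\<^sup>2"
    by (intro divide_right_mono sum_mono integral_torus_gauss_mult_le s) auto
  also have "\<dots> = (\<Sum>m=1..N. \<Sum>n=1..N. torus_gauss (sqrt 2 * s) (y m - y n)) / (real N)\<^sup>2 + wrap_error s"
    using N by (simp add: sum.distrib add_divide_distrib power2_eq_square)
  finally have square: "integral {a..a+1} (\<lambda>z. (f z)\<^sup>2) \<le> \<dots>" .
  have i: "f integrable_on {a..a+1}" "(\<lambda>z. (f z)\<^sup>2) integrable_on {a..a+1}"
    by (intro integrable_continuous_interval continuous_intros cf)+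
  have "((\<lambda>z. (f z)\<^sup>2 - 2 * f z + 1) has_integral
      (integral {a..a+1} (\<lambda>z. (f z)\<^sup>2) - 2 * integral {a..a+1} f + (a + 1 - a) * 1)) {a..a+1}"
    using has_integral_const_real[of "1::real" a "a + 1"]
    by (intro has_integral_add has_integral_diff has_integral_mult_right integrable_integral i) simp
  then have "integral {a..a+1} (\<lambda>z. (f z - 1)\<^sup>2) =
      integral {a..a+1} (\<lambda>z. (f z)\<^sup>2) - 2 * integral {a..a+1} f + 1"
    by (intro integral_unique) (simp add: power2_diff diff_add_eq)
  with mean square show ?thesis by linarith
qed

section \<open>From mean square deviation to frequencies in arcs\<close>

lemma abs_torus_eq_iff: "abs_torus u = abs_torus v \<longleftrightarrow> u - v \<in> \<int>"
  by (simp add: torus.abs_eq_iff torus_rel_def)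

lemma integral_torus_gauss_le_1:
  assumes s: "0 < s" and cd: "a \<le> c" "d \<le> a + 1"
  shows "integral {c..d} (\<lambda>z. torus_gauss s (z - y)) \<le> 1"
proof -
  have "integral {c..d} (\<lambda>z. torus_gauss s (z - y)) \<le> integral {a..a+1} (\<lambda>z. torus_gauss s (z - y))"
    using cd by (intro integral_subset_le integrable_on_torus_gauss) auto
  also have "\<dots> \<le> 1"
    unfolding integral_torus_gauss by (rule integral_normal_density_le_1[OF s])
  finally show ?thesis .
qed

text \<open>A translate of \<open>y\<close> closer than \<delta> to a point of \<open>{c..d}\<close>
  would lie in \<open>{a<..<b}\<close>. So points off the arc contribute little to the integral over
  the shrunk arc.\<close>

lemma integral_torus_gauss_off_arc:
  assumes s: "0 < s" and \<delta>: "0 < \<delta>" and cd: "a + \<delta> \<le> c" "c \<le> d" "d \<le> b - \<delta>" "d \<le> c + 1"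
    and y: "abs_torus y \<notin> abs_torus ` {a<..<b}"
  shows "integral {c..d} (\<lambda>z. torus_gauss s (z - y)) \<le> normal_density 0 s \<delta>"
proof -
  have "torus_gauss s (z - y) \<le> normal_density 0 s \<delta>" if z: "z \<in> {c..d}" for z
  proof -
    have "\<delta> \<le> int_dist (z - y)"
    proof (rule ccontr)
      assume small: "\<not> \<delta> \<le> int_dist (z - y)"
      obtain k where "int_dist (z - y) = \<bar>z - y - of_int k\<bar>" by (rule int_dist_attained)
      with small z cd have "y + of_int k \<in> {a<..<b}" by (auto simp: abs_real_def split: if_splits)
      moreover have "abs_torus y = abs_torus (y + of_int k)" by (simp add: abs_torus_eq_iff)
      ultimately show False using y by blast
    qed
    then show ?thesis
      unfolding torus_gauss_def using \<delta> by (intro normal_density_antimono) auto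
  qed
  then have "integral {c..d} (\<lambda>z. torus_gauss s (z - y)) \<le> integral {c..d} (\<lambda>_. normal_density 0 s \<delta>)"
    by (intro integral_le integrable_on_torus_gauss) auto
  also have "\<dots> = (d - c) * normal_density 0 s \<delta>" using cd by simp
  also have "\<dots> \<le> 1 * normal_density 0 s \<delta>" using cd by (intro mult_right_mono) auto
  finally show ?thesis by simp
qed

text \<open>Compare two bounds for the integral of \<open>f\<close> over the arc shrunk by \<delta>
  at both ends. From below, \<open>f\<close> is close to \<open>1\<close> in mean square, with
  \<open>r\<close> a free parameter; from above, each point in the arc contributes at most
  \<open>1\<close> plus the Gaussian tail, each other point only the tail.\<close>

lemma arc_frequency_ge:
  fixes y :: "nat \<Rightarrow> real"
  assumes s: "0 < s" and N: "1 \<le> N" and r: "0 < r" and \<delta>: "0 < \<delta>"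
    and ab: "a + 2 * \<delta> \<le> b" "b \<le> a + 1"
    and \<eta>: "(\<Sum>m=1..N. \<Sum>n=1..N. torus_gauss (sqrt 2 * s) (y m - y n)) / (real N)\<^sup>2
      + wrap_error s - 1 + 8 * s\<^sup>2 \<le> \<eta>"
  shows "b - a - 2 * \<delta> - r - \<eta> / (4 * r) - normal_density 0 s \<delta> \<le>
    real (card {n \<in> {1..N}. abs_torus (y n) \<in> abs_torus ` {a<..<b}}) / real N"
proof -
  define f where "f z = (\<Sum>n=1..N. torus_gauss s (z - y n)) / real N" for z
  define c d where "c = a + \<delta>" and "d = b - \<delta>"
  let ?S = "{n \<in> {1..N}. abs_torus (y n) \<in> abs_torus ` {a<..<b}}"
  let ?p = "normal_density 0 s \<delta>"
  have cd: "a \<le> c" "c \<le> d" "d \<le> a + 1" "d - c = b - a - 2 * \<delta>" "d - c \<le> 1"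
    using ab \<delta> by (auto simp: c_def d_def)
  have cf: "continuous_on A f" for A
    unfolding f_def using N by (intro continuous_intros continuous_on_torus_gauss) auto
  have isq: "(\<lambda>z. (f z - 1)\<^sup>2) integrable_on {u..v}" for u v
    by (intro integrable_continuous_interval continuous_intros cf)
  have "integral {c..d} (\<lambda>z. (f z - 1)\<^sup>2) \<le> integral {a..a+1} (\<lambda>z. (f z - 1)\<^sup>2)"
    using cd by (intro integral_subset_le isq) auto
  also have "\<dots> \<le> \<eta>"
    using mean_square_deviation_le[OF s N, of a y] \<eta> unfolding f_def by linarith
  finally have sq: "integral {c..d} (\<lambda>z. (f z - 1)\<^sup>2) \<le> \<eta>" .
  have I1: "((\<lambda>z. 1 - r - (f z - 1)\<^sup>2 / (4 * r)) has_integral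
      ((d - c) * (1 - r) - integral {c..d} (\<lambda>z. (f z - 1)\<^sup>2) / (4 * r))) {c..d}"
    using has_integral_const_real[of "1 - r" c d] cd
    by (intro has_integral_diff has_integral_divide integrable_integral isq) simp
  have I2: "(f has_integral integral {c..d} f) {c..d}"
    by (intro integrable_integral integrable_continuous_interval cf)
  have "1 - r - (f z - 1)\<^sup>2 / (4 * r) \<le> f z" for z
  proof -
    \<comment> \<open>AM-GM for \<open>r\<close> and \<open>(f z - 1)\<^sup>2 / (4 * r)\<close>\<close>
    have "0 \<le> (f z - 1 + 2 * r)\<^sup>2 / (4 * r)" using r by simp
    also have "\<dots> = (f z - 1)\<^sup>2 / (4 * r) + (f z - 1) + r"
      using r by (simp add: field_simps power2_eq_square)
    finally show ?thesis by linarith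
  qed
  then have "(d - c) * (1 - r) - integral {c..d} (\<lambda>z. (f z - 1)\<^sup>2) / (4 * r) \<le> integral {c..d} f"
    by (rule has_integral_le[OF I1 I2])
  moreover have "integral {c..d} (\<lambda>z. (f z - 1)\<^sup>2) / (4 * r) \<le> \<eta> / (4 * r)"
    using sq r by (intro divide_right_mono) auto
  moreover have "(d - c) * r \<le> 1 * r" using cd r by (intro mult_right_mono) auto
  ultimately have lower: "b - a - 2 * \<delta> - r - \<eta> / (4 * r) \<le> integral {c..d} f"
    using cd by (simp add: algebra_simps)
  have "integral {c..d} f = (\<Sum>n=1..N. integral {c..d} (\<lambda>z. torus_gauss s (z - y n))) / real N"
    unfolding f_def
    by (subst integral_divide, subst integral_sum) (auto intro: integrable_on_torus_gauss)
  also have "\<dots> \<le> (\<Sum>n=1..N. (if n \<in> ?S then 1 else 0) + ?p) / real N"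
  proof (intro divide_right_mono sum_mono)
    fix n assume n: "n \<in> {1..N}"
    show "integral {c..d} (\<lambda>z. torus_gauss s (z - y n)) \<le> (if n \<in> ?S then 1 else 0) + ?p"
    proof (cases "n \<in> ?S")
      case True
      then show ?thesis
        using integral_torus_gauss_le_1[OF s cd(1,3), of "y n"] by (simp add: add_increasing2)
    next
      case False
      then show ?thesis
        using integral_torus_gauss_off_arc[OF s \<delta>, of a c d b "y n"] n cd by (auto simp: c_def d_def)
    qed
  qed auto
  also have "(\<Sum>n=1..N. (if n \<in> ?S then 1 else 0) + ?p) = real (card ?S) + real N * ?p"
    by (simp add: sum.distrib flip: sum.inter_filter)
  also have "(real (card ?S) + real N * ?p) / real N = real (card ?S) / real N + ?p"
    using N by (simp add: add_divide_distrib)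
  finally show ?thesis using lower by linarith
qed

section \<open>Passage to the limit\<close>

lemma tendsto_wrap_error: "(wrap_error \<longlongrightarrow> 0) (at_right 0)"
  unfolding wrap_error_def by real_asymp

lemma tendsto_normal_density_0:
  "0 < \<delta> \<Longrightarrow> ((\<lambda>s. normal_density 0 s \<delta>) \<longlongrightarrow> 0) (at_right 0)"
  unfolding normal_density_def by real_asymp

lemma eventually_arc_frequency_ge:
  fixes y :: "nat \<Rightarrow> real" and s :: "nat \<Rightarrow> real"
  assumes s: "filterlim s (at_right 0) sequentially"
    and lim: "(\<lambda>N. (\<Sum>m=1..N. \<Sum>n=1..N. torus_gauss (sqrt 2 * s N) (y m - y n)) / (real N)\<^sup>2)
      \<longlonglongrightarrow> 1"
    and ab: "a \<le> b" "b \<le> a + 1" and \<epsilon>: "0 < \<epsilon>"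
  shows "\<forall>\<^sub>F N in sequentially. b - a - \<epsilon> \<le>
    real (card {n \<in> {1..N}. abs_torus (y n) \<in> abs_torus ` {a<..<b}}) / real N"
\<comment> \<open>If \<open>b - a\<close> is at most \<epsilon>, the bound is trivial because
  frequencies are nonnegative. Otherwise the arc is long enough to be shrunk.\<close>
proof (cases "b - a \<le> \<epsilon>")
  case True
  have "b - a - \<epsilon> \<le> real (card {n \<in> {1..N}. abs_torus (y n) \<in> abs_torus ` {a<..<b}}) / real N" for N
    by (rule order.trans[of _ 0]) (use True in auto)
  then show ?thesis by simp
next
  case False
  \<comment> \<open>The fixed losses \<open>2 * \<delta> + r\<close> add up to
    \<open>\<epsilon> / 2\<close>; the terms that vanish as \<open>N\<close> grows get the other
    half.\<close>
  define \<delta> r where "\<delta> = \<epsilon> / 8" and "r = \<epsilon> / 4"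
  define \<eta> where "\<eta> N = (\<Sum>m=1..N. \<Sum>n=1..N. torus_gauss (sqrt 2 * s N) (y m - y n)) / (real N)\<^sup>2
      + wrap_error (s N) - 1 + 8 * (s N)\<^sup>2" for N
  have pos: "0 < \<delta>" "0 < r" using \<epsilon> by (auto simp: \<delta>_def r_def)
  have s0: "s \<longlonglongrightarrow> 0" using s by (simp add: filterlim_at)
  have "\<eta> \<longlonglongrightarrow> 1 + 0 - 1 + 8 * 0\<^sup>2"
    unfolding \<eta>_def by (intro tendsto_intros lim s0 filterlim_compose[OF tendsto_wrap_error s])
  then have "(\<lambda>N. \<eta> N / (4 * r) + normal_density 0 (s N) \<delta>) \<longlonglongrightarrow> (1 + 0 - 1 + 8 * 0\<^sup>2) / (4 * r) + 0"
    using pos by (intro tendsto_intros filterlim_compose[OF tendsto_normal_density_0 s]) auto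
  then have "\<forall>\<^sub>F N in sequentially. \<eta> N / (4 * r) + normal_density 0 (s N) \<delta> < \<epsilon> / 2"
    using \<epsilon> by (intro order_tendstoD(2)) auto
  moreover have "\<forall>\<^sub>F N in sequentially. 0 < s N"
    using s by (auto simp: filterlim_at elim: eventually_mono)
  moreover have "\<forall>\<^sub>F N in sequentially. 1 \<le> N" by (rule eventually_ge_at_top)
  ultimately show ?thesis
  proof eventually_elim
    case (elim N)
    have "a + 2 * \<delta> \<le> b" using False \<epsilon> by (simp add: \<delta>_def)
    from arc_frequency_ge[OF elim(2,3) pos(2,1) this ab(2) \<eta>_def[THEN eq_refl[OF sym]], folded \<eta>_def]
    show ?case using elim(1) by (simp add: \<delta>_def r_def)
  qed
qed

text \<open>Lifts of a common point would differ by an integer strictly between \<open>0\<close> and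
  \<open>1\<close>.\<close>

lemma arcs_disjoint:
  assumes "a \<le> b" "b \<le> a + 1"
  shows "abs_torus ` {a..b} \<inter> abs_torus ` {b<..<a+1} = {}"
proof -
  have False if "u \<in> {a..b}" "v \<in> {b<..<a+1}" "abs_torus v = abs_torus u" for u v
  proof -
    from that(3) obtain k where k: "v - u = of_int k" by (auto simp: abs_torus_eq_iff elim: Ints_cases)
    have "(0::real) < of_int k" "of_int k < (1::real)" using that k by auto
    then show False by simp
  qed
  then show ?thesis by fastforce
qed

text \<open>Lower bounds on open arcs suffice: \<open>J\<close> contains the open arc with its
  endpoints, and the open arc from \<open>b\<close> to \<open>a + 1\<close> misses \<open>J\<close>,
  so its share of the points bounds the share of \<open>J\<close> from above.\<close>

lemma uniformly_distributed_abs_torusI: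
  fixes y :: "nat \<Rightarrow> real"
  assumes x: "\<And>n. x n = abs_torus (y n)"
    and lower: "\<And>a b \<epsilon>. a \<le> b \<Longrightarrow> b \<le> a + 1 \<Longrightarrow> 0 < \<epsilon> \<Longrightarrow>
      \<forall>\<^sub>F N in sequentially. b - a - \<epsilon> \<le>
        real (card {n \<in> {1..N}. abs_torus (y n) \<in> abs_torus ` {a<..<b}}) / real N"
  shows "uniformly_distributed x"
  unfolding uniformly_distributed_def
proof (intro allI impI)
  fix J l assume "is_arc J l"
  then obtain a b where ab: "a \<le> b" "b \<le> a + 1" "l = b - a"
    and J: "abs_torus ` {a<..<b} \<subseteq> J" "J \<subseteq> abs_torus ` {a..b}"
    unfolding is_arc_def by fastforce
  let ?C = "\<lambda>N A. {n \<in> {1..N::nat}. x n \<in> A}"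
  let ?K = "abs_torus ` {b<..<a+1}"
  show "(\<lambda>N. real (card (?C N J)) / real N) \<longlonglongrightarrow> l"
  proof (rule tendstoI)
    fix \<epsilon> :: real assume "0 < \<epsilon>"
    then have \<epsilon>: "0 < \<epsilon> / 2" by simp
    \<comment> \<open>This excludes \<open>N = 0\<close>, where \<open>real N / real N\<close> is
      \<open>0\<close>.\<close>
    have "\<forall>\<^sub>F N in sequentially. 1 \<le> (N::nat)" by (rule eventually_ge_at_top)
    moreover have "\<forall>\<^sub>F N in sequentially. a + 1 - b - \<epsilon> / 2 \<le> real (card (?C N ?K)) / real N"
      using lower[of b "a + 1", OF _ _ \<epsilon>] ab by (simp add: x)
    moreover note lower[OF ab(1,2) \<epsilon>]
    ultimately show "\<forall>\<^sub>F N in sequentially. dist (real (card (?C N J)) / real N) l < \<epsilon>"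
    proof eventually_elim
      case (elim N)
      have "card (?C N (abs_torus ` {a<..<b})) \<le> card (?C N J)"
        using J(1) by (intro card_mono) auto
      then have "real (card (?C N (abs_torus ` {a<..<b}))) / real N \<le> real (card (?C N J)) / real N"
        by (intro divide_right_mono) auto
      then have l: "l - \<epsilon> / 2 \<le> real (card (?C N J)) / real N"
        using elim(3) ab(3) by (simp add: x)
      have "J \<inter> ?K = {}" using arcs_disjoint[OF ab(1,2)] J(2) by blast
      then have "card (?C N J) + card (?C N ?K) = card (?C N J \<union> ?C N ?K)"
        by (intro card_Un_disjoint[symmetric]) auto
      also have "\<dots> \<le> card {1..N}" by (intro card_mono) auto
      finally have "(real (card (?C N J)) + real (card (?C N ?K))) / real N \<le> real N / real N"
        by (intro divide_right_mono) auto
      then have "real (card (?C N J)) / real N + real (card (?C N ?K)) / real N \<le> 1"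
        using elim(1) by (simp add: add_divide_distrib)
      then show ?case
        using l elim(2) ab(3) \<open>0 < \<epsilon>\<close> by (auto simp: dist_real_def abs_less_iff)
    qed
  qed
qed

section \<open>The energy of the hypothesis in terms of the kernel\<close>

text \<open>This fixes the bandwidth: \<open>s = sqrt t / 2\<close> has variance
  \<open>t / 4\<close>, which the product formula doubles to \<open>t / 2\<close>, the variance of
  the Gaussian in the hypothesis. The factor \<open>sqrt pi\<close> is what its normalization
  lacks.\<close>

lemma torus_gauss_half_variance:
  assumes "0 < t"
  shows "torus_gauss (sqrt 2 * (sqrt t / 2)) u =
    1 / sqrt t * exp (- (1 / t) * (int_dist u)\<^sup>2) / sqrt pi"
proof -
  have v: "(sqrt 2 * (sqrt t / 2))\<^sup>2 = t / 2"
    using assms by (simp add: power_mult_distrib power_divide)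
  show ?thesis
    unfolding torus_gauss_def normal_density_def v by (simp add: real_sqrt_mult)
qed

theorem mainTheorem3:
  fixes x :: "nat \<Rightarrow> torus"
  assumes "\<exists>t :: nat \<Rightarrow> real. (\<forall>n\<ge>1. t n > 0) \<and> t \<longlonglongrightarrow> 0 \<and>
    (\<lambda>N. 1 / (real N)\<^sup>2 *
        (\<Sum>m=1..N. \<Sum>n=1..N. 1 / sqrt (t N) * exp (- (1 / t N) * (torus_dist (x m) (x n))\<^sup>2)))
      \<longlonglongrightarrow> sqrt pi"
  shows "uniformly_distributed x"
proof -
  from assms obtain t :: "nat \<Rightarrow> real" where t: "\<And>n. n \<ge> 1 \<Longrightarrow> t n > 0" "t \<longlonglongrightarrow> 0"
    and lim: "(\<lambda>N. 1 / (real N)\<^sup>2 *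
        (\<Sum>m=1..N. \<Sum>n=1..N. 1 / sqrt (t N) * exp (- (1 / t N) * (torus_dist (x m) (x n))\<^sup>2)))
      \<longlonglongrightarrow> sqrt pi" (is "?E \<longlonglongrightarrow> _")
    by blast
  define y where "y n = rep_torus (x n)" for n
  have x: "x n = abs_torus (y n)" for n
    unfolding y_def using Quotient_abs_rep[OF Quotient_torus] by metis
  define s where "s n = sqrt (t n) / 2" for n
  have s0: "s \<longlonglongrightarrow> 0"
    unfolding s_def using tendsto_divide[OF tendsto_real_sqrt[OF t(2)] tendsto_const[of 2]] by simp
  have "\<forall>\<^sub>F N in sequentially. 0 < s N"
    using eventually_ge_at_top[of 1] by eventually_elim (simp add: s_def t)
  with s0 have s: "filterlim s (at_right 0) sequentially"
    by (auto simp: filterlim_at elim: eventually_mono)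
  \<comment> \<open>The identity is an eventual one because \<open>t N\<close> is assumed positive
    only from \<open>N = 1\<close> on.\<close>
  have "\<forall>\<^sub>F N in sequentially. ?E N / sqrt pi =
      (\<Sum>m=1..N. \<Sum>n=1..N. torus_gauss (sqrt 2 * s N) (y m - y n)) / (real N)\<^sup>2"
    using eventually_ge_at_top[of 1]
  proof eventually_elim
    case (elim N)
    then show ?case
      unfolding s_def torus_gauss_half_variance[OF t(1)[OF elim]]
      by (simp add: x torus_dist_abs_torus sum_divide_distrib ac_simps)
  qed
  moreover have "(\<lambda>N. ?E N / sqrt pi) \<longlonglongrightarrow> 1"
    using tendsto_divide[OF lim tendsto_const[of "sqrt pi"]] by simp
  ultimately have "(\<lambda>N. (\<Sum>m=1..N. \<Sum>n=1..N. torus_gauss (sqrt 2 * s N) (y m - y n)) / (real N)\<^sup>2)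
      \<longlonglongrightarrow> 1"
    by (rule Lim_transform_eventually[rotated])
  from eventually_arc_frequency_ge[OF s this] x show ?thesis
    by (intro uniformly_distributed_abs_torusI) auto
qed

end
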